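(* Let $k$ be a field of characteristic not $2$, let $G=\mathrm{SL}_2(\bar k)$ and $G_k=\mathrm{SL}_2(k)$, and let $\tau$ be an involution of $G$ with $\tau(G_k)=G_k$. Then $$G_k=H_k^\tau\,\widetilde{Q^\tau}\,U_k,$$ i.e. every $g\in G_k$ can be written as $g=hqu$ with $h\in H_k^\tau$, $q\in\widetilde{Q^\tau}$, $u\in U_k$.
   Context: $\bar k$ is the algebraic closure of $k$. An involution of $G$ is an automorphism of the algebraic group $G$ of order exactly $2$. $H_k^\tau=\{g\in G_k : \tau(g)=g\}$ is the group of $k$-rational points of the fixed-point group of $\tau$. $\widetilde{Q^\tau}=\{g\in G_k : \tau(g)=g^{-1}\}$ is the extended symmetric space. $U_k=\left\{\begin{pmatrix}1&u_1\\0&1\end{pmatrix} : u_1\in k\right\}$. For subsets $A,B,C\subset G_k$, $ABC=\{abc: a\in A,b\in B,c\in C\}$. *)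

theory Defs
  imports
    "HOL-Analysis.Analysis"
    "HOL-Algebra.Coset"
    "HOL-Algebra.Algebraic_Closure_Type"
    "HOL-Library.Poly_Mapping"
begin

definition SL2 :: "('a::comm_ring_1 ^ 2 ^ 2) monoid" where
  "SL2 = \<lparr>carrier = {A. det A = 1}, monoid.mult = (**), one = mat 1\<rparr>"

lemma group_SL2: "group (SL2 :: ('a::field ^ 2 ^ 2) monoid)"
proof (rule groupI)
  fix A :: "'a ^ 2 ^ 2"
  assume "A \<in> carrier SL2"
  then have "det A = 1" by (simp add: SL2_def)
  then obtain B where "B ** A = mat 1"
    using invertible_det_nz[of A] unfolding invertible_def by auto
  moreover from this have "det B = 1"
    using det_mul[of B A] \<open>det A = 1\<close> by simp
  ultimately show "\<exists>B\<in>carrier SL2. B \<otimes>\<^bsub>SL2\<^esub> A = \<one>\<^bsub>SL2\<^esub>"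
    by (auto simp: SL2_def)
qed (auto simp: SL2_def det_mul matrix_mul_assoc)

text \<open>
  A polynomial over \<open>'a\<close> in variables \<open>'v\<close> is a finitely supported family of coefficients
  indexed by monomials, and a monomial is a finitely supported family of exponents.
\<close>

definition eval_poly :: "(('v \<Rightarrow>\<^sub>0 nat) \<Rightarrow>\<^sub>0 'a::comm_ring_1) \<Rightarrow> ('v \<Rightarrow> 'a) \<Rightarrow> 'a" where
  "eval_poly p x =
    (\<Sum>m\<in>Poly_Mapping.keys p. Poly_Mapping.lookup p m *
      (\<Prod>v\<in>Poly_Mapping.keys m. x v ^ Poly_Mapping.lookup m v))"

text \<open>
  \<open>SL2\<close> is Zariski closed in affine 4-space, so over an algebraically closed field its morphisms
  of varieties are the maps given in each matrix entry by a polynomial in the four entries of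
  the argument.
\<close>

definition SL2_morphism :: "('a::alg_closed_field ^ 2 ^ 2 \<Rightarrow> 'a ^ 2 ^ 2) \<Rightarrow> bool" where
  "SL2_morphism f \<longleftrightarrow>
    f \<in> carrier SL2 \<rightarrow> carrier SL2 \<and>
    (\<forall>i j. \<exists>p :: (2 \<times> 2 \<Rightarrow>\<^sub>0 nat) \<Rightarrow>\<^sub>0 'a. \<forall>g\<in>carrier SL2.
      f g $ i $ j = eval_poly p (\<lambda>(r, c). g $ r $ c))"

text \<open>
  Regularity of the inverse is not automatic: in characteristic \<open>p\<close>, the Frobenius map is a
  bijective regular homomorphism but not an automorphism of the algebraic group.
\<close>

definition SL2_algebraic_automorphism :: "('a::alg_closed_field ^ 2 ^ 2 \<Rightarrow> 'a ^ 2 ^ 2) \<Rightarrow> bool" where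
  "SL2_algebraic_automorphism f \<longleftrightarrow>
    f \<in> iso SL2 SL2 \<and> SL2_morphism f \<and> SL2_morphism (inv_into (carrier SL2) f)"

definition SL2_involution :: "('a::alg_closed_field ^ 2 ^ 2 \<Rightarrow> 'a ^ 2 ^ 2) \<Rightarrow> bool" where
  "SL2_involution f \<longleftrightarrow>
    SL2_algebraic_automorphism f \<and>
    (\<forall>g\<in>carrier SL2. f (f g) = g) \<and> (\<exists>g\<in>carrier SL2. f g \<noteq> g)"

text \<open>
  The groups of rational points over \<open>'k\<close> are taken as subsets of the group over the algebraic
  closure, via the embedding \<open>to_ac\<close>.
\<close>

definition SL2_points :: "('k::field alg_closure ^ 2 ^ 2) set" where
  "SL2_points = map_matrix to_ac ` carrier SL2"

definition U_points :: "('k::field alg_closure ^ 2 ^ 2) set" where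
  "U_points = {vector [vector [1, to_ac u], vector [0, 1]] | u. True}"

definition H_points ::
    "('k::field alg_closure ^ 2 ^ 2 \<Rightarrow> 'k alg_closure ^ 2 ^ 2) \<Rightarrow> ('k alg_closure ^ 2 ^ 2) set" where
  "H_points \<tau> = {g \<in> SL2_points. \<tau> g = g}"

definition extended_symmetric_space ::
    "('k::field alg_closure ^ 2 ^ 2 \<Rightarrow> 'k alg_closure ^ 2 ^ 2) \<Rightarrow> ('k alg_closure ^ 2 ^ 2) set" where
  "extended_symmetric_space \<tau> = {g \<in> SL2_points. \<tau> g = inv\<^bsub>SL2\<^esub> g}"

end

theory Submission
  imports Defs
begin

text \<open>
  A regular automorphism maps the upper unipotent subgroup to a commuting family of unipotent
  matrices, hence, up to conjugation, acts on it as an additive polynomial with polynomial inverse,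
  which must be linear. After a further conjugation the automorphism also fixes the Weyl element,
  so it is inner. An involution is therefore conjugation by a matrix \<open>A\<close> of trace zero, and it can
  be scaled to have entries in \<open>k\<close> because the involution preserves the rational points. Then
  \<open>q\<close> lies in the extended symmetric space iff \<open>q ** A\<close> has trace zero, so with \<open>g = h ** q ** u\<close>
  the trace condition on \<open>h\<^sup>-\<^sup>1 ** g ** u\<^sup>-\<^sup>1 ** A\<close> is linear in the entry of \<open>u\<close>, and it is
  solvable for a suitable \<open>h\<close> in the norm-one group of \<open>k[A]\<close>.
\<close>

no_notation fps_nth (infixl \<open>$\<close> 75)

subsection \<open>Two-by-two matrices\<close>

definition mat2 :: "'a \<Rightarrow> 'a \<Rightarrow> 'a \<Rightarrow> 'a \<Rightarrow> 'a::comm_ring_1 ^ 2 ^ 2" where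
  "mat2 a b c d = vector [vector [a, b], vector [c, d]]"

definition unip :: "'a \<Rightarrow> 'a::comm_ring_1 ^ 2 ^ 2" where
  "unip t = mat2 1 t 0 1"

definition weyl :: "'a::comm_ring_1 ^ 2 ^ 2" where
  "weyl = mat2 0 1 (-1) 0"

lemma mat2_nth [simp]:
  "mat2 a b c d $ 1 $ 1 = a" "mat2 a b c d $ 1 $ 2 = b"
  "mat2 a b c d $ 2 $ 1 = c" "mat2 a b c d $ 2 $ 2 = d"
  by (simp_all add: mat2_def)

lemma mat2_eta: "A = mat2 (A $ 1 $ 1) (A $ 1 $ 2) (A $ 2 $ 1) (A $ 2 $ 2)"
  by (simp add: vec_eq_iff forall_2)

lemma mat2_cases [cases type]:
  obtains a b c d where "A = mat2 a b c d"
  using mat2_eta by blast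

lemma mat2_eq_iff [simp]:
  "mat2 a b c d = mat2 a' b' c' d' \<longleftrightarrow> a = a' \<and> b = b' \<and> c = c' \<and> d = d'"
  by (auto simp: vec_eq_iff forall_2)

lemma mat2_mult [simp]:
  "mat2 a b c d ** mat2 a' b' c' d' =
    mat2 (a * a' + b * c') (a * b' + b * d') (c * a' + d * c') (c * b' + d * d')"
  by (simp add: vec_eq_iff forall_2 matrix_matrix_mult_def sum_2)

lemma det_mat2 [simp]: "det (mat2 a b c d) = a * d - b * c"
  by (simp add: det_2)

lemma trace_mat2 [simp]: "trace (mat2 a b c d) = a + d"
  by (simp add: trace_def sum_2)

lemma mat_one_mat2: "mat 1 = mat2 1 0 0 1"
  by (simp add: vec_eq_iff forall_2 mat_def)

lemma mat_mat2: "mat x = mat2 x 0 0 x"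
  by (simp add: vec_eq_iff forall_2 mat_def)

lemma mat_mult_commute: "mat x ** A = A ** mat x" for A :: "'a::comm_ring_1 ^ 2 ^ 2"
  by (cases A) (simp add: mat_mat2 mult.commute)

lemma matrix_right_cancel:
  fixes A :: "'a::field ^ 'n ^ 'n"
  assumes "det A \<noteq> 0" "B ** A = C ** A"
  shows "B = C"
proof -
  obtain A' where "A ** A' = mat 1"
    using assms(1) invertible_det_nz[of A] unfolding invertible_def by blast
  then show ?thesis
    by (metis assms(2) matrix_mul_assoc matrix_mul_rid)
qed

lemma map_matrix_mat2 [simp]: "map_matrix f (mat2 a b c d) = mat2 (f a) (f b) (f c) (f d)"
  by (simp add: vec_eq_iff forall_2)

lemma in_SL2 [simp]: "A \<in> carrier SL2 \<longleftrightarrow> det A = 1"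
  and mult_SL2 [simp]: "A \<otimes>\<^bsub>SL2\<^esub> B = A ** B"
  and one_SL2 [simp]: "\<one>\<^bsub>SL2\<^esub> = mat 1"
  by (simp_all add: SL2_def)

lemma det_unip [simp]: "det (unip t) = 1"
  and det_weyl [simp]: "det weyl = 1"
  by (simp_all add: unip_def weyl_def)

text \<open>An induction principle: with nonzero lower left entry, a matrix is a product of an
  upper, a lower and an upper unipotent, and a right factor \<open>weyl\<close> brings the other
  matrices into this case.\<close>

lemma SL2_generated:
  fixes g :: "'a::field ^ 2 ^ 2"
  assumes g: "det g = 1"
    and unip: "\<And>t. unip t \<in> S"
    and weyl: "weyl \<in> S"
    and mult: "\<And>g h. g \<in> S \<Longrightarrow> h \<in> S \<Longrightarrow> g ** h \<in> S"
  shows "g \<in> S"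
proof -
  have lower: "mat2 1 0 t 1 \<in> S" for t
  proof -
    \<comment> \<open>As \<open>S\<close> is only closed under products, the inverse of
      \<open>weyl\<close> is written as its cube.\<close>
    have "mat2 1 0 t 1 = weyl ** weyl ** weyl ** unip (-t) ** weyl"
      by (simp add: weyl_def unip_def)
    then show ?thesis by (simp add: unip weyl mult)
  qed
  have gen: "mat2 a b c d \<in> S" if "a * d - b * c = 1" "c \<noteq> 0" for a b c d
  proof -
    have "mat2 a b c d = unip ((a - 1) / c) ** mat2 1 0 c 1 ** unip ((d - 1) / c)"
      using that by (simp add: unip_def field_simps)
    then show ?thesis by (simp add: unip lower mult)
  qed
  obtain a b c d where g_eq: "g = mat2 a b c d" by (cases g)
  show ?thesis
  proof (cases "c = 0")
    case True
    have "mat2 a b c d = mat2 (-b) a (-d) c ** weyl ** weyl ** weyl"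
      by (simp add: weyl_def)
    moreover have "mat2 (-b) a (-d) c \<in> S"
      using g True by (intro gen) (auto simp: g_eq)
    ultimately show ?thesis by (simp add: g_eq weyl mult)
  qed (use g g_eq gen in auto)
qed

subsection \<open>Factorization over the base field\<close>

text \<open>For invertible \<open>A\<close> this is Cayley-Hamilton: \<open>q ** A\<close> and
  \<open>A\<close> have trace zero and the same determinant, so their squares are the same scalar
  matrix, and a factor \<open>A\<close> cancels. The computation in entries covers singular
  \<open>A\<close> as well.\<close>

lemma antifixed_if_trace_zero:
  fixes q :: "'a::idom ^ 2 ^ 2"
  assumes "det q = 1" "trace A = 0" "trace (q ** A) = 0"
  shows "q ** A ** q = A"
proof -
  obtain p r s t where q: "q = mat2 p r s t" by (cases q)
  obtain a b c d where A: "A = mat2 a b c d" by (cases A)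
  have d: "d = -a" using assms(2) by (simp add: A add_eq_0_iff)
  have 1: "p * t - r * s = 1" and 2: "p * a + r * c + (s * b - t * a) = 0"
    using assms by (simp_all add: q A d)
  have "(p * a + r * c) * p + (p * b + r * - a) * s = a"
    "(p * a + r * c) * r + (p * b + r * - a) * t = b"
    "(s * a + t * c) * p + (s * b + t * - a) * s = c"
    "(s * a + t * c) * r + (s * b + t * - a) * t = - a"
    using 1 2 by Groebner_Basis.algebra+
  then show ?thesis by (simp only: q A d mat2_mult)
qed

text \<open>The first factor in \<open>tr\<close> is m + n A. Since \<open>A\<close> squares to
  \<open>a\<^sup>2 + b * c\<close>, \<open>norm_one\<close> says that m - n A is its inverse; this
  is the \<open>h\<close> taken, and it commutes with \<open>A\<close>.\<close>

lemma factorization_step: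
  fixes a b c :: "'a::field" and m n x :: 'a
  defines "A \<equiv> mat2 a b c (-a)"
  assumes g: "det g = 1" and norm_one: "m\<^sup>2 - (a\<^sup>2 + b * c) * n\<^sup>2 = 1"
    and tr: "trace (mat2 (m + a * n) (b * n) (c * n) (m - a * n) ** g ** unip (-x) ** A) = 0"
  shows "\<exists>h q x. det h = 1 \<and> det q = 1 \<and> h ** A = A ** h \<and> q ** A ** q = A \<and> g = h ** q ** unip x"
proof (intro exI conjI)
  let ?h = "mat2 (m - a * n) (- (b * n)) (- (c * n)) (m + a * n)"
  let ?h' = "mat2 (m + a * n) (b * n) (c * n) (m - a * n)"
  let ?q = "?h' ** g ** unip (-x)"
  show "det ?h = 1"
    using norm_one by (simp add: power2_eq_square algebra_simps)
  have "det ?h' = 1"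
    using norm_one by (simp add: power2_eq_square algebra_simps)
  then show det_q: "det ?q = 1"
    by (simp only: det_mul g det_unip mult_1)
  show "?h ** A = A ** ?h"
    by (simp add: A_def algebra_simps)
  show "?q ** A ** ?q = A"
    by (rule antifixed_if_trace_zero[OF det_q _ tr]) (simp add: A_def)
  have 1: "?h ** ?h' = mat 1"
    using norm_one by (simp add: mat_one_mat2 power2_eq_square algebra_simps)
  have 2: "unip (-x) ** unip x = mat 1"
    by (simp add: mat_one_mat2 unip_def)
  have "?h ** ?q ** unip x = (?h ** ?h') ** g ** (unip (-x) ** unip x)"
    by (simp only: matrix_mul_assoc)
  also have "\<dots> = g" by (simp only: 1 2 matrix_mul_lid matrix_mul_rid)
  finally show "g = ?h ** ?q ** unip x" by simp
qed

text \<open>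
  Put \<open>d = a\<^sup>2 + b * c\<close>, so that \<open>A\<^sup>2 = d\<close>. If the lower left entry of \<open>A ** g\<close> is nonzero, then
  \<open>h = 1\<close> works. Otherwise \<open>A ** g\<close> is upper triangular with diagonal \<open>t, -d / t\<close>. If \<open>c = 0\<close>, then
  \<open>q = 1\<close> works; if \<open>c \<noteq> 0\<close> and \<open>t\<^sup>2 = d\<close>, then \<open>A ** g\<close> has trace zero and \<open>q = g\<close> works; in the
  remaining case the inverse of \<open>(t + A)\<^sup>2 / (t\<^sup>2 - d)\<close> is a suitable \<open>h\<close>.
\<close>

lemma factorization_mat2:
  fixes g :: "'a::field ^ 2 ^ 2" and a b c :: 'a
  defines "A \<equiv> mat2 a b c (-a)"
  assumes two: "(2::'a) \<noteq> 0" and D: "a\<^sup>2 + b * c \<noteq> 0" and g: "det g = 1"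
  shows "\<exists>h q x. det h = 1 \<and> det q = 1 \<and> h ** A = A ** h \<and> q ** A ** q = A \<and> g = h ** q ** unip x"
proof -
  obtain p q r s where g_eq: "g = mat2 p q r s" by (cases g)
  have det: "p * s - q * r = 1" using g by (simp add: g_eq)
  define t where "t = a * p + b * r"
  note step = factorization_step[OF g, of _ a b c, folded A_def]
  have lower_left: ?thesis
    if norm_one: "m\<^sup>2 - (a\<^sup>2 + b * c) * n\<^sup>2 = 1"
      and ne: "m * (c * p - a * r) + n * (a\<^sup>2 + b * c) * r \<noteq> 0" for m n
  proof -
    \<comment> \<open>By cyclicity of the trace, the factor \<open>unip (-x)\<close> lowers it by
      \<open>x\<close> times the lower left entry of A (m + n A) g, which is \<open>w\<close>. So
      \<open>x = z / w\<close> makes the trace vanish.\<close>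
    define w where "w = m * (c * p - a * r) + n * (a\<^sup>2 + b * c) * r"
    define z where "z = trace (mat2 (m + a * n) (b * n) (c * n) (m - a * n) ** g ** A)"
    have "trace (mat2 (m + a * n) (b * n) (c * n) (m - a * n) ** g ** unip (-x) ** A) = z - x * w"
      for x
      unfolding w_def g_eq A_def unip_def z_def
      by (simp add: algebra_simps power2_eq_square)
    from this[of "z / w"]
    have "trace (mat2 (m + a * n) (b * n) (c * n) (m - a * n) ** g ** unip (-(z / w)) ** A) = 0"
      using ne by (simp add: w_def)
    then show ?thesis by (rule step[OF norm_one])
  qed
  show ?thesis
  proof (cases "c * p - a * r = 0")
    case False
    then show ?thesis using lower_left[of 1 0] by simp
  next
    case ll: True
    show ?thesis
    proof (cases "c = 0")
      case True
      with D have "a \<noteq> 0" by auto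
      with ll True have r: "r = 0" by simp
      with det have ps: "p * s = 1" by simp
      \<comment> \<open>Now \<open>g\<close> is upper triangular with diagonal \<open>p\<close>,
        \<open>s\<close>, and m + n A is to have diagonal \<open>s\<close>, \<open>p\<close>. Its
        product with \<open>g\<close> is then unipotent, with \<open>x\<close> below as upper right
        entry.\<close>
      define m where "m = (s + p) / 2"
      define n where "n = (s - p) / (2 * a)"
      have an: "a * n = (s - p) / 2"  using \<open>a \<noteq> 0\<close> by (simp add: n_def)
      have mp: "m + a * n = s" and mm: "m - a * n = p"
        unfolding an m_def using two
        by (simp_all flip: add_divide_distrib diff_divide_distrib mult_2)
      have "m\<^sup>2 - (a\<^sup>2 + b * c) * n\<^sup>2 = (m + a * n) * (m - a * n)"
        unfolding True by Groebner_Basis.algebra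
      also have "\<dots> = 1" unfolding mp mm using ps by (simp add: mult.commute)
      finally have norm_one: "m\<^sup>2 - (a\<^sup>2 + b * c) * n\<^sup>2 = 1" .
      define x where "x = s * q + b * n * s"
      have "mat2 (m + a * n) (b * n) (c * n) (m - a * n) ** g ** unip (-x) = mat 1"
        unfolding mp mm g_eq True r unip_def mat_one_mat2 mat2_mult x_def
        using ps by (simp add: algebra_simps)
      then show ?thesis by (intro step[OF norm_one, of x]) (simp add: A_def)
    next
      case False
      have r: "r \<noteq> 0"
      proof
        assume "r = 0"
        with ll False have "p = 0" by simp
        with \<open>r = 0\<close> det show False by simp
      qed
      \<comment> \<open>Both sides are the lower left entry of \<open>A ** A ** g\<close>, computed
        from the triangular \<open>A ** g\<close> and from the scalar \<open>A ** A\<close>.\<close>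
      have tp: "t * c = (a\<^sup>2 + b * c) * r"
        unfolding t_def using ll by Groebner_Basis.algebra
      have t0: "t \<noteq> 0" using tp D r by auto
      show ?thesis
      proof (cases "t\<^sup>2 = a\<^sup>2 + b * c")
        case True
        \<comment> \<open>The diagonal entries of \<open>A ** g\<close> are \<open>t\<close> and
          \<open>- (a\<^sup>2 + b * c) / t\<close>.\<close>
        have "t * trace (g ** A) = t\<^sup>2 - (a\<^sup>2 + b * c)"
          unfolding g_eq A_def using ll det 
          by (simp only: mat2_mult trace_mat2 t_def) Groebner_Basis.algebra
        with True t0 have "trace (g ** A) = 0" by simp
        moreover have "mat2 (1 + a * 0) (b * 0) (c * 0) (1 - a * 0) = mat 1"
          "unip (-0) = mat (1::'a)"
          by (simp_all add: mat_one_mat2 unip_def)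
        ultimately show ?thesis
          by (intro step[of 1 0 0]) (simp_all add: matrix_mul_lid matrix_mul_rid)
      next
        case neq: False
        \<comment> \<open>\<open>e\<close> is the norm of t + A, so m + n A, the square of t + A
          divided by \<open>e\<close>, has norm one. In \<open>lower_left\<close> the term with
          \<open>m\<close> vanishes, and the one with \<open>n\<close> is nonzero because 2
          is.\<close>
        define e where "e = t\<^sup>2 - (a\<^sup>2 + b * c)"
        have e: "e \<noteq> 0" using neq by (simp add: e_def)
        define m where "m = (t\<^sup>2 + (a\<^sup>2 + b * c)) / e"
        define n where "n = 2 * t / e"
        have em: "e * m = t\<^sup>2 + (a\<^sup>2 + b * c)" and en: "e * n = 2 * t"
          using e by (simp_all add: m_def n_def)
        have "e\<^sup>2 * (m\<^sup>2 - (a\<^sup>2 + b * c) * n\<^sup>2) = (e * m)\<^sup>2 - (a\<^sup>2 + b * c) * (e * n)\<^sup>2"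
          by (simp add: algebra_simps power2_eq_square)
        also have "\<dots> = e\<^sup>2"
          unfolding em en unfolding e_def by (simp add: algebra_simps power2_eq_square)
        finally have "m\<^sup>2 - (a\<^sup>2 + b * c) * n\<^sup>2 = 1" using e by simp
        then show ?thesis
          using ll D r e two t0 by (intro lower_left[of m n]) (auto simp: n_def)
      qed
    qed
  qed
qed

subsection \<open>Regular automorphisms are inner\<close>

definition poly_fun :: "('a::comm_ring_1 \<Rightarrow> 'a) \<Rightarrow> bool" where
  "poly_fun h \<longleftrightarrow> (\<exists>p. \<forall>t. h t = poly p t)"

lemma poly_fun_const [simp]: "poly_fun (\<lambda>t. c)"
  unfolding poly_fun_def by (rule exI[of _ "[:c:]"]) simp

lemma poly_fun_ident [simp]: "poly_fun (\<lambda>t. t)"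
  unfolding poly_fun_def by (rule exI[of _ "[:0, 1:]"]) simp

lemma poly_fun_add: "poly_fun f \<Longrightarrow> poly_fun g \<Longrightarrow> poly_fun (\<lambda>t. f t + g t)"
  unfolding poly_fun_def by (metis poly_add)

lemma poly_fun_mult: "poly_fun f \<Longrightarrow> poly_fun g \<Longrightarrow> poly_fun (\<lambda>t. f t * g t)"
  unfolding poly_fun_def by (metis poly_mult)

lemma poly_fun_power: "poly_fun f \<Longrightarrow> poly_fun (\<lambda>t. f t ^ n)"
  unfolding poly_fun_def by (metis poly_power)

lemma poly_fun_sum: "(\<And>i. i \<in> I \<Longrightarrow> poly_fun (f i)) \<Longrightarrow> poly_fun (\<lambda>t. \<Sum>i\<in>I. f i t)"
  by (induction I rule: infinite_finite_induct) (simp_all add: poly_fun_add)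

lemma poly_fun_prod: "(\<And>i. i \<in> I \<Longrightarrow> poly_fun (f i)) \<Longrightarrow> poly_fun (\<lambda>t. \<Prod>i\<in>I. f i t)"
  by (induction I rule: infinite_finite_induct) (simp_all add: poly_fun_mult)

lemma poly_fun_eval_poly:
  "(\<And>v. poly_fun (x v)) \<Longrightarrow> poly_fun (\<lambda>t. eval_poly p (\<lambda>v. x v t))"
  unfolding eval_poly_def
  by (intro poly_fun_sum poly_fun_mult poly_fun_const poly_fun_prod poly_fun_power)

lemma poly_fun_matrix_mult:
  assumes "\<And>i j. poly_fun (\<lambda>t. A t $ i $ j)" "\<And>i j. poly_fun (\<lambda>t. B t $ i $ j)"
  shows "poly_fun (\<lambda>t. (A t ** B t) $ i $ j)"
  unfolding matrix_matrix_mult_def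
  by (simp, intro poly_fun_sum poly_fun_mult assms)

lemma unip_add: "unip s ** unip t = unip (s + t)"
  by (simp add: unip_def add.commute)

lemma poly_fun_unip: "poly_fun (\<lambda>t. unip t $ i $ j)"
  using exhaust_2[of i] exhaust_2[of j] by (auto simp: unip_def)

text \<open>Restricting a regular map to a polynomial curve in SL2 reduces questions about
  automorphisms to polynomials in one variable.\<close>

lemma poly_fun_SL2_morphism:
  assumes "SL2_morphism f" "\<And>i j. poly_fun (\<lambda>t. A t $ i $ j)" "\<And>t. det (A t) = 1"
  shows "poly_fun (\<lambda>t. f (A t) $ i $ j)"
proof -
  obtain p where p: "\<And>g. det g = 1 \<Longrightarrow> f g $ i $ j = eval_poly p (\<lambda>(r, c). g $ r $ c)"
    using assms(1) unfolding SL2_morphism_def in_SL2 Ball_def by metis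
  show ?thesis
    unfolding p[OF assms(3)] case_prod_beta
    by (intro poly_fun_eval_poly assms(2))
qed

lemma infinite_UNIV_alg_closed: "infinite (UNIV :: 'a::alg_closed_field set)"
proof
  assume fin: "finite (UNIV :: 'a set)"
  \<comment> \<open>Over a finite field \<open>p\<close> vanishes everywhere, so
    \<open>p + 1\<close> has positive degree but no root.\<close>
  define p :: "'a poly" where "p = (\<Prod>a\<in>UNIV. [:-a, 1:])"
  have "Polynomial.degree p = card (UNIV :: 'a set)"
    unfolding p_def by (subst degree_prod_eq_sum_degree) auto
  with fin have "Polynomial.degree (p + 1) > 0"
    by (subst degree_add_eq_left) (auto simp: card_gt_0_iff)
  then obtain x where "poly (p + 1) x = 0"
    using alg_closed_imp_poly_has_root by blast
  moreover have "poly p x = 0"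
    using fin by (auto simp: p_def poly_prod)
  ultimately show False by simp
qed

lemma poly_eqI_cofinite:
  fixes p q :: "'a::alg_closed_field poly"
  assumes "finite S" "\<And>t. t \<notin> S \<Longrightarrow> poly p t = poly q t"
  shows "p = q"
proof (rule ccontr)
  assume "p \<noteq> q"
  then have "finite {t. poly (p - q) t = 0}"
    by (intro poly_roots_finite) simp
  moreover have "UNIV \<subseteq> S \<union> {t. poly (p - q) t = 0}"
    using assms(2) by auto
  ultimately show False
    using assms(1) infinite_UNIV_alg_closed finite_subset by blast
qed

text \<open>Degrees multiply under composition, so a polynomial left inverse forces degree
  one.\<close>

lemma poly_fun_left_invertible_linear:
  fixes \<alpha> \<beta> :: "'a::alg_closed_field \<Rightarrow> 'a"
  assumes "poly_fun \<alpha>" "poly_fun \<beta>" "\<And>t. \<beta> (\<alpha> t) = t" "\<alpha> 0 = 0" "\<alpha> 1 = 1"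
  shows "\<alpha> t = t"
proof -
  obtain p q where p: "\<And>t. \<alpha> t = poly p t" and q: "\<And>t. \<beta> t = poly q t"
    using assms(1,2) unfolding poly_fun_def by blast
  have "q \<circ>\<^sub>p p = [:0, 1:]"
    by (rule poly_eqI_cofinite[of "{}"]) (use assms(3) in \<open>simp_all add: poly_pcompose p q\<close>)
  then have "Polynomial.degree q * Polynomial.degree p = 1"
    by (metis degree_pcompose degree_pCons_eq_if degree_1 one_neq_zero one_pCons One_nat_def)
  then have "Polynomial.degree p = 1" by simp
  then obtain a b where "p = [:a, b:]"
    by (metis degree1_coeffs)
  with assms(4,5) show ?thesis by (simp add: p)
qed

text \<open>N - 1 has square zero, so a vector v not killed by it gives a basis (N - 1) v, v, the
  columns of \<open>P\<close>. The second standard vector serves as v if \<open>b\<close> is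
  nonzero, the first one otherwise.\<close>

lemma unipotent_normal_form:
  fixes N :: "'a::field ^ 2 ^ 2"
  assumes "det N = 1" "trace N = 2" "N \<noteq> mat 1"
  obtains P Q where "P ** Q = mat 1" "Q ** P = mat 1" "Q ** N ** P = unip 1"
proof -
  obtain a b c d where N: "N = mat2 a b c d" by (cases N)
  have d: "d = 2 - a" using assms(2) by (simp add: N algebra_simps)
  have bc: "b * c = - ((a - 1) * (a - 1))" using assms(1) by (simp add: N d algebra_simps)
  show thesis
  proof (cases "b = 0")
    case False
    with bc have c: "c = - ((a - 1) * (a - 1)) / b" by (simp add: field_simps)
    have "mat2 b 0 (1 - a) 1 ** mat2 (1 / b) 0 ((a - 1) / b) 1 = mat 1"
      "mat2 (1 / b) 0 ((a - 1) / b) 1 ** mat2 b 0 (1 - a) 1 = mat 1"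
      using False by (simp_all add: mat_one_mat2 field_simps)
    moreover have "mat2 (1 / b) 0 ((a - 1) / b) 1 ** N ** mat2 b 0 (1 - a) 1 = unip 1"
      using False by (simp add: N d c unip_def field_simps)
    ultimately show thesis by (rule that)
  next
    case True
    with bc have a: "a = 1" by simp
    with d True assms(3) have c: "c \<noteq> 0" by (auto simp: N mat_one_mat2)
    have "mat2 0 1 c 0 ** mat2 0 (1 / c) 1 0 = mat 1" "mat2 0 (1 / c) 1 0 ** mat2 0 1 c 0 = mat 1"
      "mat2 0 (1 / c) 1 0 ** N ** mat2 0 1 c 0 = unip 1"
      using c by (simp_all add: mat_one_mat2 N unip_def a d True)
    then show thesis by (rule that)
  qed
qed

lemma unipotent_commuting_unip:
  fixes G :: "'a::field ^ 2 ^ 2"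
  assumes "det G = 1" "trace G = 2" "G ** unip 1 = unip 1 ** G"
  shows "G = unip (G $ 1 $ 2)"
proof -
  obtain a b c d where G: "G = mat2 a b c d" by (cases G)
  have c: "c = 0" and d: "d = a"
    using assms(3) by (simp_all add: G unip_def)
  \<comment> \<open>The trace alone does not determine \<open>a\<close> in characteristic 2, so it
    is combined with the determinant.\<close>
  have "(a - 1)\<^sup>2 = a * a - (a + a) + 1"
    by (simp add: power2_eq_square algebra_simps)
  also have "\<dots> = 0" using assms(1,2) by (simp add: G c d)
  finally have "a = 1" by simp
  then show ?thesis by (simp add: G unip_def c d)
qed

text \<open>
  The relation used is \<open>(w u(-1))\<^sup>2 = u(1) w\<close> for \<open>u = unip\<close> and \<open>w = weyl\<close>.
\<close>

lemma hom_fixing_unip_inner: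
  fixes f :: "'a::field ^ 2 ^ 2 \<Rightarrow> 'a ^ 2 ^ 2"
  assumes det_f: "\<And>A. det A = 1 \<Longrightarrow> det (f A) = 1"
    and mult: "\<And>A B. det A = 1 \<Longrightarrow> det B = 1 \<Longrightarrow> f (A ** B) = f A ** f B"
    and inj: "\<And>A B. det A = 1 \<Longrightarrow> det B = 1 \<Longrightarrow> f A = f B \<Longrightarrow> A = B"
    and unip: "\<And>t. f (unip t) = unip t"
  obtains x where "\<And>g. det g = 1 \<Longrightarrow> f g ** unip x = unip x ** g"
proof -
  obtain a b c d where M: "f weyl = mat2 a b c d" by (cases "f weyl")
  have det: "a * d - b * c = 1"
    using det_f[of weyl] by (simp add: M)
  have "weyl ** unip (-1) ** weyl ** unip (-1) = unip 1 ** (weyl :: 'a ^ 2 ^ 2)"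
    by (simp add: weyl_def unip_def)
  then have "f (weyl ** unip (-1) ** weyl ** unip (-1)) = f (unip 1 ** weyl)" by simp
  then have "f weyl ** unip (-1) ** f weyl ** unip (-1) = unip 1 ** f weyl"
    by (simp add: mult unip det_mul)
  then have rel: "mat2 a (b - a) c (d - c) ** mat2 a (b - a) c (d - c) = mat2 (a + c) (b + d) c d"
    by (simp add: M unip_def algebra_simps)
  \<comment> \<open>If \<open>c\<close> were zero, \<open>f weyl\<close> would be upper unipotent
    and hence already the image of some \<open>unip b\<close>.\<close>
  have c: "c \<noteq> 0"
  proof
    assume "c = 0"
    with rel det have "a = 1" "d = 1" by auto
    then have "f weyl = f (unip b)" by (simp only: M unip \<open>c = 0\<close>) (simp only: unip_def)
    then have "weyl = unip b" by (rule inj[rotated 2]) simp_all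
    then show False by (simp add: weyl_def unip_def)
  qed
  have "c * (a + d - c) = c" using rel by (simp add: algebra_simps)
  then have tr: "a + d - c = 1" using c by simp
  have "a * a + (b - a) * c = a + c" using rel by simp
  moreover have "a * a + (b - a) * c = a * (a + d - c) - (a * d - b * c)"
    by (simp add: algebra_simps)
  ultimately have "c = -1" using tr det by (simp add: eq_neg_iff_add_eq_0)
  with tr have d: "d = -a" by (simp add: add_eq_0_iff)
  with det \<open>c = -1\<close> have b: "b = 1 + a * a" by (simp add: algebra_simps)
  \<comment> \<open>\<open>f weyl\<close> is now the conjugate of \<open>weyl\<close> by
    \<open>unip (-a)\<close>, and this conjugation fixes every \<open>unip t\<close>. So it agrees
    with \<open>f\<close> on generators.\<close>
  define S where "S = {g. det g = 1 \<and> f g ** unip (-a) = unip (-a) ** g}"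
  have "g \<in> S" if "det g = 1" for g
    using that
  proof (rule SL2_generated)
    show "unip t \<in> S" for t
      by (simp add: S_def unip) (simp add: unip_def)
    show "weyl \<in> S"
      by (simp add: S_def M) (simp add: unip_def weyl_def \<open>c = -1\<close> d b)
    show "g ** h \<in> S" if "g \<in> S" "h \<in> S" for g h
      using that unfolding S_def
      by (simp add: det_mul mult) (metis matrix_mul_assoc)
  qed
  then show thesis by (intro that[of "-a"]) (simp add: S_def)
qed

lemma SL2_algebraic_automorphismD:
  assumes "SL2_algebraic_automorphism f"
  shows "det A = 1 \<Longrightarrow> det (f A) = 1"
    and "det A = 1 \<Longrightarrow> det B = 1 \<Longrightarrow> f (A ** B) = f A ** f B"
    and "det A = 1 \<Longrightarrow> det B = 1 \<Longrightarrow> f A = f B \<Longrightarrow> A = B"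
    and "f (mat 1) = mat 1"
proof -
  have iso: "f \<in> iso SL2 SL2"
    using assms by (simp add: SL2_algebraic_automorphism_def)
  then have hom: "f \<in> hom SL2 SL2" and inj: "inj_on f (carrier SL2)"
    by (auto simp: iso_def bij_betw_def)
  show "det A = 1 \<Longrightarrow> det (f A) = 1"
    using hom_in_carrier[OF hom, of A] by simp
  show "det A = 1 \<Longrightarrow> det B = 1 \<Longrightarrow> f (A ** B) = f A ** f B"
    using hom_mult[OF hom, of A B] by simp
  show "det A = 1 \<Longrightarrow> det B = 1 \<Longrightarrow> f A = f B \<Longrightarrow> A = B"
    using inj by (auto simp: inj_on_def)
  show "f (mat 1) = mat 1"
    using hom_one[OF hom group_SL2 group_SL2] by simp
qed

text \<open>
  The torus permutes the nonidentity elements of the root subgroup transitively, so their images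
  all have the same trace, and by continuity it is the trace of the identity. Regularity of the
  inverse enters only to make \<open>\<alpha>\<close> linear.
\<close>

lemma automorphism_unip:
  fixes f :: "'a::alg_closed_field ^ 2 ^ 2 \<Rightarrow> 'a ^ 2 ^ 2"
  assumes f: "SL2_algebraic_automorphism f"
  obtains P Q where "P ** Q = mat 1" "Q ** P = mat 1" "\<And>t. Q ** f (unip t) ** P = unip t"
proof -
  note det_f = SL2_algebraic_automorphismD(1)[OF f]
    and mult_f = SL2_algebraic_automorphismD(2)[OF f]
    and inj_f = SL2_algebraic_automorphismD(3)[OF f]
    and one_f = SL2_algebraic_automorphismD(4)[OF f]
  define f' where "f' = inv_into (carrier SL2) f"
  have morph: "SL2_morphism f" "SL2_morphism f'"
    using f by (simp_all add: SL2_algebraic_automorphism_def f'_def)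
  have f'_f: "f' (f A) = A" if "det A = 1" for A
    using inj_f that unfolding f'_def by (intro inv_into_f_f inj_onI) auto
  have unip_0: "unip 0 = mat 1"
    by (simp add: unip_def mat_one_mat2)
  note poly_f = poly_fun_SL2_morphism[OF morph(1) poly_fun_unip det_unip]

  have trace: "trace (f (unip t)) = 2" for t
  proof -
    have conj: "trace (f (unip t)) = trace (f (unip 1))" if "t \<noteq> 0" for t
    proof -
      obtain s where s: "s\<^sup>2 = t" using nth_root_exists[of 2 t] by auto
      with that have "s \<noteq> 0" by auto
      let ?D = "mat2 s 0 0 (1 / s)" and ?D' = "mat2 (1 / s) 0 0 s"
      have det: "det ?D = 1" "det ?D' = 1" using \<open>s \<noteq> 0\<close> by simp_all
      have "unip t = ?D ** unip 1 ** ?D'"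
        using \<open>s \<noteq> 0\<close> s by (simp add: unip_def power2_eq_square)
      then have "f (unip t) = f ?D ** f (unip 1) ** f ?D'"
        by (simp only: mult_f det_mul det det_unip mult_1)
      then have "trace (f (unip t)) = trace (f ?D' ** (f ?D ** f (unip 1)))"
        by (metis trace_mul_sym)
      also have "f ?D' ** (f ?D ** f (unip 1)) = f (?D' ** ?D ** unip 1)"
        by (simp only: mult_f det_mul det det_unip mult_1) (simp only: matrix_mul_assoc)
      also have "?D' ** ?D = mat 1" using \<open>s \<noteq> 0\<close> by (simp add: mat_one_mat2)
      finally show ?thesis by (simp only: matrix_mul_lid)
    qed
    have "poly_fun (\<lambda>t. trace (f (unip t)))"
      unfolding trace_def by (intro poly_fun_sum poly_f)
    then obtain p where p: "\<And>t. trace (f (unip t)) = poly p t"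
      unfolding poly_fun_def by blast
    have "p = [:poly p 1:]"
    proof (rule poly_eqI_cofinite)
      show "poly p t = poly [:poly p 1:] t" if "t \<notin> {0}" for t
        using conj[of t] that by (simp add: p)
    qed simp
    then obtain c where "p = [:c:]" by (rule that)
    then have "trace (f (unip t)) = trace (f (unip 0))"
      by (simp add: p)
    then show ?thesis
      by (simp add: unip_0 one_f) (simp add: mat_one_mat2)
  qed
  have "f (unip 1) \<noteq> mat 1"
    using inj_f[of "unip 1" "mat 1"] by (auto simp: one_f) (simp add: unip_def mat_one_mat2)
  then obtain P Q where PQ: "P ** Q = mat 1" "Q ** P = mat 1" and Q1: "Q ** f (unip 1) ** P = unip 1"
    using unipotent_normal_form[OF det_f[OF det_unip] trace] by blast
  have det_QP: "det Q * det P = 1" and det_PQ: "det P * det Q = 1"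
    by (simp_all add: PQ flip: det_mul)
  \<comment> \<open>After conjugation the image of \<open>unip 1\<close> is \<open>unip 1\<close>
    itself; the other images commute with it, hence are upper unipotent, and \<open>\<alpha>\<close>
    is their parameter.\<close>
  define \<alpha> where "\<alpha> t = (Q ** f (unip t) ** P) $ 1 $ 2" for t
  have conj: "Q ** f (unip t) ** P = unip (\<alpha> t)" for t
    unfolding \<alpha>_def
  proof (rule unipotent_commuting_unip)
    show "det (Q ** f (unip t) ** P) = 1"
      using det_QP det_f[OF det_unip] by (simp add: det_mul)
    have "trace (Q ** f (unip t) ** P) = trace (P ** Q ** f (unip t))"
      by (metis trace_mul_sym matrix_mul_assoc)
    then show "trace (Q ** f (unip t) ** P) = 2"
      by (simp add: PQ trace)
    have "(Q ** f (unip s) ** P) ** (Q ** f (unip t) ** P) = Q ** f (unip (s + t)) ** P" for s t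
    proof -
      have "(Q ** f (unip s) ** P) ** (Q ** f (unip t) ** P)
          = Q ** f (unip s) ** (P ** Q) ** f (unip t) ** P"
        by (simp only: matrix_mul_assoc)
      also have "\<dots> = Q ** (f (unip s) ** f (unip t)) ** P"
        by (simp only: PQ matrix_mul_rid) (simp only: matrix_mul_assoc)
      also have "f (unip s) ** f (unip t) = f (unip (s + t))"
        by (simp add: unip_add flip: mult_f)
      finally show ?thesis .
    qed
    from this[of t 1] this[of 1 t]
    show "Q ** f (unip t) ** P ** unip 1 = unip 1 ** (Q ** f (unip t) ** P)"
      by (simp add: Q1 add.commute)
  qed
  have "\<alpha> t = t" for t
  proof (rule poly_fun_left_invertible_linear)
    show "poly_fun \<alpha>"
      unfolding \<alpha>_def by (intro poly_fun_matrix_mult poly_f poly_fun_const)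
    \<comment> \<open>A left inverse of \<open>\<alpha>\<close>: undo the conjugation, apply the
      inverse automorphism and read off the parameter.\<close>
    show "poly_fun (\<lambda>x. f' (P ** unip x ** Q) $ 1 $ 2)"
    proof (rule poly_fun_SL2_morphism[OF morph(2)])
      show "poly_fun (\<lambda>x. (P ** unip x ** Q) $ i $ j)" for i j
        by (intro poly_fun_matrix_mult poly_fun_unip poly_fun_const)
    qed (simp add: det_mul det_PQ)
    show "f' (P ** unip (\<alpha> t) ** Q) $ 1 $ 2 = t" for t
    proof -
      have "P ** unip (\<alpha> t) ** Q = (P ** Q) ** f (unip t) ** (P ** Q)"
        by (simp only: matrix_mul_assoc flip: conj)
      then show ?thesis by (simp add: PQ f'_f) (simp add: unip_def)
    qed
    show "\<alpha> 0 = 0"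
      by (simp add: \<alpha>_def unip_0 one_f PQ) (simp add: mat_one_mat2)
    show "\<alpha> 1 = 1"
      by (simp add: \<alpha>_def Q1) (simp add: unip_def)
  qed
  with conj PQ that show thesis by simp
qed

text \<open>Once \<open>f\<close> is conjugated to fix every \<open>unip t\<close>, it is
  conjugation by some \<open>unip x\<close>; the two conjugations combine to
  \<open>P ** unip x\<close>.\<close>

lemma SL2_algebraic_automorphism_inner:
  fixes f :: "'a::alg_closed_field ^ 2 ^ 2 \<Rightarrow> 'a ^ 2 ^ 2"
  assumes f: "SL2_algebraic_automorphism f"
  obtains A where "det A \<noteq> 0" "\<And>g. det g = 1 \<Longrightarrow> f g ** A = A ** g"
proof -
  obtain P Q where PQ: "P ** Q = mat 1" "Q ** P = mat 1"
    and unip: "\<And>t. Q ** f (unip t) ** P = unip t"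
    using automorphism_unip[OF f] by blast
  have det_QP: "det Q * det P = 1"
    by (simp add: PQ flip: det_mul)
  have cancel: "P ** (Q ** B ** P) = B ** P" "P ** (Q ** B ** P) ** Q = B" for B
    by (simp_all add: matrix_mul_assoc PQ)
       (metis PQ(1) matrix_mul_assoc matrix_mul_rid)
  obtain x where x: "\<And>g. det g = 1 \<Longrightarrow> (Q ** f g ** P) ** unip x = unip x ** g"
  proof (rule hom_fixing_unip_inner[of "\<lambda>g. Q ** f g ** P"])
    show "det (Q ** f A ** P) = 1" if "det A = 1" for A
      using SL2_algebraic_automorphismD(1)[OF f that] det_QP by (simp add: det_mul)
    show "Q ** f (A ** B) ** P = (Q ** f A ** P) ** (Q ** f B ** P)" if "det A = 1" "det B = 1" for A B
    proof -
      have "(Q ** f A ** P) ** (Q ** f B ** P) = Q ** f A ** (P ** (Q ** f B ** P))"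
        by (simp only: matrix_mul_assoc)
      then show ?thesis
        by (simp only: cancel SL2_algebraic_automorphismD(2)[OF f that]) (simp only: matrix_mul_assoc)
    qed
    show "A = B" if "det A = 1" "det B = 1" "Q ** f A ** P = Q ** f B ** P" for A B
      using SL2_algebraic_automorphismD(3)[OF f that(1,2)] that(3) cancel(2) by metis
  qed (use unip in auto)
  show thesis
  proof (rule that[of "P ** unip x"])
    show "det (P ** unip x) \<noteq> 0" using det_QP by (auto simp: det_mul)
    show "f g ** (P ** unip x) = (P ** unip x) ** g" if "det g = 1" for g
      using x[OF that] cancel(1)[of "f g"] by (metis matrix_mul_assoc)
  qed
qed

subsection \<open>Rationality of the conjugating matrix\<close>

text \<open>\<open>A ** A\<close> commutes with \<open>unip 1\<close> and \<open>weyl\<close>, so it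
  is scalar. By Cayley-Hamilton it equals tr(A) A - det(A), so a nonzero trace would make
  \<open>A\<close> scalar and \<open>f\<close> trivial.\<close>

lemma conj_involution_trace_zero:
  fixes A :: "'a::field ^ 2 ^ 2"
  assumes A: "det A \<noteq> 0" "\<And>g. det g = 1 \<Longrightarrow> f g ** A = A ** g"
    and f: "\<And>g. det g = 1 \<Longrightarrow> det (f g) = 1" "\<And>g. det g = 1 \<Longrightarrow> f (f g) = g"
    and nontrivial: "det g\<^sub>0 = 1" "f g\<^sub>0 \<noteq> g\<^sub>0"
  shows "trace A = 0"
proof (rule ccontr)
  assume tr: "trace A \<noteq> 0"
  obtain a b c d where A_eq: "A = mat2 a b c d" by (cases A)
  have comm: "g ** (A ** A) = A ** A ** g" if "det g = 1" for g
  proof -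
    have "g ** (A ** A) = f (f g) ** A ** A"
      by (simp only: f(2)[OF that] matrix_mul_assoc)
    also have "\<dots> = A ** (f g ** A)"
      by (simp only: A(2)[OF f(1)[OF that]] flip: matrix_mul_assoc)
    also have "\<dots> = A ** A ** g"
      by (simp only: A(2)[OF that] matrix_mul_assoc)
    finally show ?thesis .
  qed
  obtain p q r s where AA: "A ** A = mat2 p q r s" by (cases "A ** A")
  have "r = 0" "p = s"
    using comm[OF det_unip, of 1] by (simp_all add: AA unip_def)
  with AA have AA: "A ** A = mat2 p q 0 p" by simp
  have "q = 0"
    using comm[OF det_weyl] by (simp add: AA weyl_def)
  with AA have "c * a + d * c = 0" "a * b + b * d = 0" "a * a + b * c = c * b + d * d"
    by (simp_all add: A_eq)
  then have "c * (a + d) = 0" "b * (a + d) = 0" "(a - d) * (a + d) = 0"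
    by (simp_all add: algebra_simps)
  then have scalar: "c = 0" "b = 0" "d = a"
    using tr by (simp_all add: A_eq)
  then have "f g\<^sub>0 ** A = g\<^sub>0 ** A"
    using A(2)[OF nontrivial(1)] by (cases g\<^sub>0) (simp add: A_eq mult.commute)
  with nontrivial(2) show False using matrix_right_cancel[OF A(1)] by blast
qed

section \<open>Matrices with entries in the base field\<close>

lemma SL2_points_iff: "A \<in> SL2_points \<longleftrightarrow> (\<exists>g. A = map_matrix to_ac g \<and> det g = 1)"
  by (auto simp: SL2_points_def)

lemma map_matrix_to_ac_mult:
  fixes A B :: "'k::field ^ 2 ^ 2"
  shows "map_matrix to_ac (A ** B) = map_matrix to_ac A ** map_matrix to_ac B"
  by (cases A; cases B) simp

lemma det_map_matrix_to_ac: "det (map_matrix to_ac A) = to_ac (det (A :: 'k::field ^ 2 ^ 2))"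
  by (cases A) simp

lemma SL2_points_mult: "A \<in> SL2_points \<Longrightarrow> B \<in> SL2_points \<Longrightarrow> A ** B \<in> SL2_points"
  unfolding SL2_points_iff by (metis det_mul map_matrix_to_ac_mult mult_1)

text \<open>
  If \<open>A\<^sup>2 = d\<close>, the images of the elementary matrices under conjugation by \<open>A\<close> are
  \<open>A E A / d\<close>; their entries are the products of two entries of \<open>A\<close>, divided by \<open>d\<close>.
\<close>

lemma rational_conj_matrix:
  fixes A :: "'k::field alg_closure ^ 2 ^ 2"
  assumes det: "det A \<noteq> 0" and tr: "trace A = 0"
    and conj: "\<And>g. g \<in> SL2_points \<Longrightarrow> \<exists>g'\<in>SL2_points. g' ** A = A ** g"
  obtains l and a b c :: 'k where "l \<noteq> 0" "A = map_matrix to_ac (mat2 a b c (-a)) ** mat l"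
proof -
  obtain a b c d where "A = mat2 a b c d" by (cases A)
  with tr have A: "A = mat2 a b c (-a)" by (simp add: add_eq_0_iff)
  define e where "e = a * a + b * c"
  have e: "e \<noteq> 0" using det by (auto simp: A e_def neg_eq_iff_add_eq_0)
  have "A ** A = mat2 e 0 0 e" by (simp add: A e_def algebra_simps)
  then have sandwich: "g' ** mat2 e 0 0 e = A ** g ** A" if "g' ** A = A ** g" for g g'
    by (simp add: matrix_mul_assoc that flip: \<open>A ** A = _\<close>)
  have rational: "\<exists>p q r s. mat2 (to_ac p) (to_ac q) (to_ac r) (to_ac s) ** mat2 e 0 0 e
      = A ** map_matrix to_ac g ** A" if det_g: "det g = 1" for g
  proof -
    have "map_matrix to_ac g \<in> SL2_points"
      using det_g unfolding SL2_points_iff by blast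
    from conj[OF this] obtain h where h: "map_matrix to_ac h ** A = A ** map_matrix to_ac g"
      unfolding Bex_def SL2_points_iff by blast
    obtain p q r s where "h = mat2 p q r s" by (cases h)
    then show ?thesis
      using sandwich[OF h] unfolding \<open>h = _\<close> map_matrix_mat2 by blast
  qed
  obtain p q r s where upper:
    "mat2 (to_ac p) (to_ac q) (to_ac r) (to_ac s) ** mat2 e 0 0 e
      = A ** map_matrix to_ac (unip 1) ** A"
    using rational[OF det_unip] by blast
  have "det (mat2 1 0 1 1 :: 'k ^ 2 ^ 2) = 1" by simp
  then obtain p' q' r' s' where lower:
    "mat2 (to_ac p') (to_ac q') (to_ac r') (to_ac s') ** mat2 e 0 0 e
      = A ** map_matrix to_ac (mat2 1 0 1 1) ** A"
    using rational by blast
  have upper_eq: "A ** map_matrix to_ac (unip 1) ** A = mat2 (e + a * c) (- (a * a)) (c * c) (e - a * c)"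
    by (simp add: A unip_def e_def algebra_simps)
  have lower_eq: "A ** map_matrix to_ac (mat2 1 0 1 1) ** A = mat2 (e + a * b) (b * b) (- (a * a)) (e - a * b)"
    by (simp add: A e_def algebra_simps)
  have ac: "a * c = to_ac (p - 1) * e" and aa: "a * a = to_ac (- q) * e" and cc: "c * c = to_ac r * e"
    using upper unfolding upper_eq by (simp_all add: algebra_simps)
  have ab: "a * b = to_ac (p' - 1) * e"
    using lower unfolding lower_eq by (simp add: algebra_simps)
  \<comment> \<open>If the products of \<open>y\<close> with \<open>x\<close> and with itself are
    rational multiples of the same \<open>e\<close>, then the quotient of \<open>x\<close> by
    \<open>y\<close> is rational.\<close>
  have scale: "\<exists>w. x = y * to_ac w"
    if "y * x = to_ac u * e" "y * y = to_ac v * e" "y \<noteq> 0" for x y u v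
  proof
    have "to_ac v \<noteq> 0" using that by auto
    moreover have "y * y * to_ac u * e = y * x * to_ac v * e"
      using that by (simp add: algebra_simps)
    ultimately show "x = y * to_ac (u / v)" using that(3) e by (simp add: field_simps)
  qed
  show thesis
  proof (cases "a = 0")
    case False
    obtain u v where "b = a * to_ac u" "c = a * to_ac v"
      using scale[OF ab aa False] scale[OF ac aa False] by blast
    then have "A = map_matrix to_ac (mat2 1 u v (-1)) ** mat a"
      by (simp add: A mat_mat2 mult.commute)
    then show thesis by (rule that[OF False])
  next
    case True
    \<comment> \<open>Now \<open>e\<close> is \<open>b * c\<close>, so \<open>c\<close> can replace
      \<open>a\<close> as the entry to divide by.\<close>
    then have "c * b = to_ac 1 * e" and c: "c \<noteq> 0" using e by (auto simp: e_def)
    then obtain u where "b = c * to_ac u" using scale[OF _ cc c] by blast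
    then have "A = map_matrix to_ac (mat2 0 u 1 (-0)) ** mat c"
      by (simp add: A True mat_mat2 mult.commute)
    then show thesis by (rule that[OF c])
  qed
qed

section \<open>Transfer of the factorization to the rational points\<close>

theorem theorem3p2:
  fixes \<tau> :: "'k::field alg_closure ^ 2 ^ 2 \<Rightarrow> 'k alg_closure ^ 2 ^ 2"
  assumes "CHAR('k) \<noteq> 2"
    and "SL2_involution \<tau>"
    and "\<tau> ` SL2_points = SL2_points"
  shows "SL2_points =
    H_points \<tau> <#>\<^bsub>SL2\<^esub> extended_symmetric_space \<tau> <#>\<^bsub>SL2\<^esub> U_points"
proof
  let ?i = "map_matrix to_ac :: 'k ^ 2 ^ 2 \<Rightarrow> _"
  have U: "U_points = range (\<lambda>x. ?i (unip x))"
    by (auto simp: U_points_def unip_def mat2_def[symmetric])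
  have "U_points \<subseteq> (SL2_points :: ('k alg_closure ^ 2 ^ 2) set)"
    unfolding U SL2_points_def by (auto intro!: imageI)
  then show "H_points \<tau> <#>\<^bsub>SL2\<^esub> extended_symmetric_space \<tau> <#>\<^bsub>SL2\<^esub> U_points \<subseteq> SL2_points"
    by (auto simp: set_mult_def H_points_def extended_symmetric_space_def intro!: SL2_points_mult)

  have aut: "SL2_algebraic_automorphism \<tau>" and invol: "\<And>g. det g = 1 \<Longrightarrow> \<tau> (\<tau> g) = g"
    using assms(2) by (auto simp: SL2_involution_def)
  obtain B where det_B: "det B \<noteq> 0" and B: "\<And>g. det g = 1 \<Longrightarrow> \<tau> g ** B = B ** g"
    using SL2_algebraic_automorphism_inner[OF aut] by blast
  obtain g\<^sub>0 where "det g\<^sub>0 = 1" "\<tau> g\<^sub>0 \<noteq> g\<^sub>0"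
    using assms(2) by (auto simp: SL2_involution_def)
  then have "trace B = 0"
    using conj_involution_trace_zero[OF det_B B SL2_algebraic_automorphismD(1)[OF aut] invol] by blast
  moreover have "\<exists>g'\<in>SL2_points. g' ** B = B ** g" if "g \<in> SL2_points" for g
  proof
    show "\<tau> g ** B = B ** g"
      using that by (intro B) (auto simp: SL2_points_iff det_map_matrix_to_ac)
    show "\<tau> g \<in> SL2_points" using assms(3) that by blast
  qed
  ultimately obtain l a b c where l: "l \<noteq> 0" and "B = ?i (mat2 a b c (-a)) ** mat l"
    by (rule rational_conj_matrix[OF det_B])
  define A where "A = mat2 a b c (-a)"
  \<comment> \<open>The scalar \<open>l\<close> cancels in the conjugation, so \<open>\<tau>\<close>
    is conjugation by a matrix over \<open>k\<close>.\<close>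
  have A: "\<tau> g ** ?i A = ?i A ** g" if "det g = 1" for g
  proof (rule matrix_right_cancel)
    show "det (mat l :: 'k alg_closure ^ 2 ^ 2) \<noteq> 0" using l by (simp add: mat_mat2)
    show "\<tau> g ** ?i A ** mat l = ?i A ** g ** mat l"
      using B[OF that] unfolding \<open>B = _\<close> A_def
      by (simp only: mat_mult_commute flip: matrix_mul_assoc)
  qed
  have det_iA: "det (?i A) \<noteq> 0"
    using det_B unfolding \<open>B = _\<close> A_def det_mul by auto
  have "det (?i A) = - to_ac (a\<^sup>2 + b * c)"
    by (simp add: A_def power2_eq_square)
  with det_iA have disc: "a\<^sup>2 + b * c \<noteq> 0"
    by (simp only: neg_equal_0_iff_equal to_ac_eq_0_iff not_False_eq_True)
  have two: "(2 :: 'k) \<noteq> 0"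
  proof
    assume "(2 :: 'k) = 0"
    then have "CHAR('k) dvd 2"
      using of_nat_eq_0_iff_char_dvd[of 2, where 'a = 'k] by simp
    then show False
      using assms(1) two_is_prime_nat CHAR_not_1[where 'a = 'k] by (auto simp: prime_nat_iff)
  qed

  show "SL2_points \<subseteq> H_points \<tau> <#>\<^bsub>SL2\<^esub> extended_symmetric_space \<tau> <#>\<^bsub>SL2\<^esub> U_points"
  proof
    fix y :: "'k alg_closure ^ 2 ^ 2"
    assume "y \<in> SL2_points"
    then obtain g where y: "y = ?i g" and "det g = 1" by (auto simp: SL2_points_iff)
    then obtain h q x where det: "det h = 1" "det q = 1"
      and h: "h ** A = A ** h" and q: "q ** A ** q = A" and g: "g = h ** q ** unip x"
      using factorization_mat2[OF two disc, of g] unfolding A_def by blast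
    have det_i: "det (?i h) = 1" "det (?i q) = 1"
      using det by (simp_all add: det_map_matrix_to_ac)
    have "\<tau> (?i h) ** ?i A = ?i h ** ?i A"
      unfolding A[OF det_i(1)] by (simp flip: map_matrix_to_ac_mult add: h)
    then have "\<tau> (?i h) = ?i h"
      by (rule matrix_right_cancel[OF det_iA])
    then have h_in: "?i h \<in> H_points \<tau>"
      using det by (auto simp: H_points_def SL2_points_iff)
    \<comment> \<open>Multiplied by \<open>A\<close> on the right, the condition that
      \<open>q\<close> times its image under \<open>\<tau>\<close> is 1 becomes
      \<open>q ** A ** q = A\<close>.\<close>
    have "(?i q ** \<tau> (?i q)) ** ?i A = ?i q ** ?i A ** ?i q"
      by (simp only: A[OF det_i(2)] flip: matrix_mul_assoc)
    also have "\<dots> = mat 1 ** ?i A"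
      by (simp flip: map_matrix_to_ac_mult add: q)
    finally have "?i q ** \<tau> (?i q) = mat 1"
      by (rule matrix_right_cancel[OF det_iA])
    then have "\<tau> (?i q) ** ?i q = mat 1"
      by (simp add: matrix_left_right_inverse)
    then have "inv\<^bsub>SL2\<^esub> (?i q) = \<tau> (?i q)"
      using det_i(2) SL2_algebraic_automorphismD(1)[OF aut det_i(2)]
      by (intro group.inv_equality[OF group_SL2]) simp_all
    then have q_in: "?i q \<in> extended_symmetric_space \<tau>"
      using det by (auto simp: extended_symmetric_space_def SL2_points_iff)
    have "y = ?i h \<otimes>\<^bsub>SL2\<^esub> ?i q \<otimes>\<^bsub>SL2\<^esub> ?i (unip x)"
      by (simp add: y g map_matrix_to_ac_mult)
    with h_in q_in show "y \<in> H_points \<tau> <#>\<^bsub>SL2\<^esub> extended_symmetric_space \<tau> <#>\<^bsub>SL2\<^esub> U_points"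
      unfolding set_mult_def U by blast
  qed
qed

end
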